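(* For every integer $k\geq 2$, the limit $\lim_{n\to\infty}|\mathcal H_n^k(321)|^{1/n}$ exists and $$\lim_{n\to\infty}|\mathcal H_n^k(321)|^{1/n}=4.$$
   Context: A permutation $\sigma=\sigma_1\cdots\sigma_n$ of $[n]=\{1,\ldots,n\}$ avoids $321$ if there are no indices $a<b<c$ with $\sigma_a>\sigma_b>\sigma_c$. A complete $k$-ary tree is a rooted tree in which every vertex not in the penultimate or last level has exactly $k$ children and all vertices in the last level are as far left as possible. Equivalently, if $v_1,\ldots,v_n$ are the vertices in breadth-first order (starting from the root, level by level, each level from left to right), then the children of $v_i$ are those $v_j$ with $k(i-1)+2\le j\le ki+1$ and $j\le n$. For each $n$ there is exactly one complete $k$-ary tree with $n$ vertices. An $n$-vertex $k$-ary heap is a bijective labeling of the vertices of this tree by $[n]$ such that each vertex has a label smaller than the labels of its children. The permutation associated to a $k$-ary heap is the permutation obtained by reading the labels of $v_1,v_2,\ldots,v_n$ in this order. $\mathcal H_n^k(321)$ is the set of $n$-vertex $k$-ary heaps whose associated permutations avoid $321$. *)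

theory Defs
  imports Complex_Main "HOL-Combinatorics.Permutations"
begin

text \<open>
  The vertices of the complete \<open>k\<close>-ary tree with \<open>n\<close> vertices are identified with
  their positions \<open>1, \<dots>, n\<close> in breadth-first order.
\<close>

definition tree_children :: "nat \<Rightarrow> nat \<Rightarrow> nat \<Rightarrow> nat set" where
  "tree_children k n i = {j. k * (i - 1) + 2 \<le> j \<and> j \<le> k * i + 1 \<and> j \<le> n}"

text \<open>
  A labeling sends the position of a vertex to its label.  As vertices are positions in
  breadth-first order, the permutation associated to a heap (its one-line notation being
  \<open>\<sigma> 1, \<dots>, \<sigma> n\<close>) is the labeling itself.  Requiring \<open>\<sigma> permutes {1..n}\<close> fixes \<open>\<sigma>\<close>
  outside \<open>{1..n}\<close>, so that distinct functions are distinct labelings.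
\<close>

definition kary_heap :: "nat \<Rightarrow> nat \<Rightarrow> (nat \<Rightarrow> nat) \<Rightarrow> bool" where
  "kary_heap k n \<sigma> \<longleftrightarrow>
     \<sigma> permutes {1..n} \<and> (\<forall>i\<in>{1..n}. \<forall>j\<in>tree_children k n i. \<sigma> i < \<sigma> j)"

definition avoids_321 :: "nat \<Rightarrow> (nat \<Rightarrow> nat) \<Rightarrow> bool" where
  "avoids_321 n \<sigma> \<longleftrightarrow>
     \<not> (\<exists>a\<in>{1..n}. \<exists>b\<in>{1..n}. \<exists>c\<in>{1..n}. a < b \<and> b < c \<and> \<sigma> a > \<sigma> b \<and> \<sigma> b > \<sigma> c)"

definition heaps_321 :: "nat \<Rightarrow> nat \<Rightarrow> (nat \<Rightarrow> nat) set" where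
  "heaps_321 k n = {\<sigma>. kary_heap k n \<sigma> \<and> avoids_321 n \<sigma>}"

end

theory Submission
  imports Defs "HOL-Library.FuncSet" "HOL-Library.Infinite_Set" "HOL-Real_Asymp.Real_Asymp"
begin

text \<open>
  A 321-avoiding permutation is increasing on its left-to-right maxima and on the remaining
  positions, so it is determined by the positions and the values of these maxima; this gives the
  upper bound \<open>4 ^ n\<close>.

  For the lower bound, two sets \<open>A\<close> and \<open>B\<close> of equal size determine a 321-avoiding permutation
  mapping \<open>A\<close> increasingly onto \<open>B\<close> and the complement of \<open>A\<close> increasingly onto that of \<open>B\<close>.
  If \<open>A\<close> strictly precedes \<open>B\<close>, then \<open>A\<close> is the set of excedances, so that \<open>(A, B)\<close> can be
  recovered. If moreover \<open>A\<close> and \<open>B\<close> have equally many elements in each block of a fixed length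
  \<open>m\<close>, then inversions stay inside blocks, and parent-child pairs do not, so the permutation is a
  heap. There are \<open>t\<close> choices per block, whence at least about \<open>t ^ (n / m)\<close> heaps. Finally
  \<open>t powr (1 / m)\<close> gets arbitrarily close to 4: concatenate many pairs of equinumerous subsets of a
  shorter interval of length \<open>L\<close>, and make the result strictly dominated by prepending an interval
  of length \<open>L\<close> to \<open>A\<close> and appending one to \<open>B\<close>.
\<close>

section \<open>Ranks and increasing maps on sets of naturals\<close>

text \<open>The count below a threshold is monotone and jumps just after \<open>a\<close>. Order
  comparisons thus become comparisons of counts, which is how positions and values are located
  throughout.\<close>

lemma card_below_less_iff:
  fixes A :: "nat set"
  assumes "a \<in> A"
  shows "card (A \<inter> {..<a}) < card (A \<inter> {..<t}) \<longleftrightarrow> a < t"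
proof
  assume "a < t"
  then have "A \<inter> {..<a} \<subset> A \<inter> {..<t}" using assms by auto
  then show "card (A \<inter> {..<a}) < card (A \<inter> {..<t})" by (intro psubset_card_mono) auto
next
  assume *: "card (A \<inter> {..<a}) < card (A \<inter> {..<t})"
  show "a < t"
  proof (rule ccontr)
    assume "\<not> a < t"
    then have "card (A \<inter> {..<t}) \<le> card (A \<inter> {..<a})" by (intro card_mono) auto
    with * show False by simp
  qed
qed

lemma card_below_diff:
  fixes A :: "nat set"
  assumes "A \<subseteq> {..<n}" "t \<le> n"
  shows "card (({..<n} - A) \<inter> {..<t}) + card (A \<inter> {..<t}) = t"
proof -
  have "card (({..<n} - A) \<inter> {..<t} \<union> A \<inter> {..<t}) =
      card (({..<n} - A) \<inter> {..<t}) + card (A \<inter> {..<t})"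
    by (rule card_Un_disjoint) auto
  moreover have "({..<n} - A) \<inter> {..<t} \<union> A \<inter> {..<t} = {..<t}" using assms by auto
  ultimately show ?thesis by simp
qed

lemma strict_mono_on_card_below:
  fixes f :: "nat \<Rightarrow> nat"
  assumes "strict_mono_on A f" "i \<in> A"
  shows "card (f ` A \<inter> {..<f i}) = card (A \<inter> {..<i})"
proof -
  have lt: "f j < f i \<longleftrightarrow> j < i" if "j \<in> A" for j
    using strict_mono_on_less[OF assms(1) that assms(2)] .
  have "f ` A \<inter> {..<f i} = f ` (A \<inter> {..<i})"
    using lt by auto
  moreover have "inj_on f (A \<inter> {..<i})"
    using strict_mono_on_imp_inj_on[OF assms(1)] inj_on_subset by blast
  ultimately show ?thesis by (simp add: card_image)
qed

text \<open>An increasing map preserves ranks, so \<open>f i\<close> has in the image the rank that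
  \<open>i\<close> has in \<open>A\<close>. The right-hand side mentions \<open>f\<close> only
  through its image.\<close>

lemma strict_mono_on_less_iff_card_below:
  fixes f :: "nat \<Rightarrow> nat"
  assumes "strict_mono_on A f" "i \<in> A"
  shows "f i < t \<longleftrightarrow> card (A \<inter> {..<i}) < card (f ` A \<inter> {..<t})"
  using card_below_less_iff[of "f i" "f ` A" t] strict_mono_on_card_below[OF assms] assms(2)
  by simp

lemma strict_mono_on_image_eqD:
  fixes f g :: "nat \<Rightarrow> nat"
  assumes "strict_mono_on A f" "strict_mono_on A g" "f ` A = g ` A" "i \<in> A"
  shows "f i = g i"
proof -
  have "f i < t \<longleftrightarrow> g i < t" for t
    using strict_mono_on_less_iff_card_below[OF assms(1,4), of t]
      strict_mono_on_less_iff_card_below[OF assms(2,4), of t] assms(3) by simp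
  from this[of "f i"] this[of "g i"] show ?thesis by simp
qed

lemma ex_strict_mono_on_image_eq:
  fixes A B :: "nat set"
  assumes "finite A" "finite B" "card A = card B"
  shows "\<exists>f. strict_mono_on A f \<and> f ` A = B"
proof -
  obtain h where h: "bij_betw h {..<card A} A" "strict_mono_on {..<card A} h"
    using ex_bij_betw_strict_mono_card[OF assms(1)] by blast
  obtain g where g: "bij_betw g {..<card B} B" "strict_mono_on {..<card B} g"
    using ex_bij_betw_strict_mono_card[OF assms(2)] by blast
  define k where "k = inv_into {..<card A} h"
  have k: "k x \<in> {..<card A}" "h (k x) = x" if "x \<in> A" for x
    using h(1) that unfolding k_def bij_betw_def
    by (metis inv_into_into, metis f_inv_into_f)
  have "k x < k y" if "x \<in> A" "y \<in> A" "x < y" for x y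
    using strict_mono_on_less[OF h(2) k(1)[OF that(1)] k(1)[OF that(2)]] k(2) that by simp
  then have "strict_mono_on A (g \<circ> k)"
    using g(2) k(1) assms(3) unfolding strict_mono_on_def by (metis comp_apply)
  moreover have "k ` A = {..<card A}"
    using h(1) unfolding k_def bij_betw_def by (metis inv_into_image_cancel order_refl)
  then have "(g \<circ> k) ` A = B"
    using g(1) assms(3) unfolding bij_betw_def by (metis image_comp)
  ultimately show ?thesis by blast
qed

section \<open>The upper bound\<close>

lemma finite_heaps_321 [simp]: "finite (heaps_321 k n)"
  by (rule finite_subset[OF _ finite_permutations[of "{1..n}"]])
    (auto simp: heaps_321_def kary_heap_def)

definition lr_maxima :: "nat \<Rightarrow> (nat \<Rightarrow> nat) \<Rightarrow> nat set" where
  "lr_maxima n \<sigma> = {i \<in> {1..n}. \<forall>j\<in>{1..<i}. \<sigma> j < \<sigma> i}"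

lemma strict_mono_on_lr_maxima: "strict_mono_on (lr_maxima n \<sigma>) \<sigma>"
  by (auto simp: lr_maxima_def strict_mono_on_def)

text \<open>Each such position has a larger value somewhere before it, so a descent between two of
  them would complete a 321 pattern.\<close>

lemma strict_mono_on_non_lr_maxima:
  assumes "\<sigma> permutes {1..n}" "avoids_321 n \<sigma>"
  shows "strict_mono_on ({1..n} - lr_maxima n \<sigma>) \<sigma>"
proof (rule strict_mono_onI)
  fix i j assume ij: "i \<in> {1..n} - lr_maxima n \<sigma>" "j \<in> {1..n} - lr_maxima n \<sigma>" "i < j"
  then obtain a where a: "a \<in> {1..<i}" "\<not> \<sigma> a < \<sigma> i" by (auto simp: lr_maxima_def)
  have inj: "inj \<sigma>" using assms(1) by (rule permutes_inj)
  have "\<sigma> a > \<sigma> i" using a injD[OF inj, of a i] by fastforce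
  moreover have "\<sigma> i \<noteq> \<sigma> j" using ij injD[OF inj, of i j] by auto
  moreover have "\<not> (\<sigma> a > \<sigma> i \<and> \<sigma> i > \<sigma> j)"
  proof
    assume "\<sigma> a > \<sigma> i \<and> \<sigma> i > \<sigma> j"
    moreover have "a \<in> {1..n}" "i \<in> {1..n}" "j \<in> {1..n}" "a < i" using a ij by auto
    ultimately show False using assms(2) ij(3) unfolding avoids_321_def by blast
  qed
  ultimately show "\<sigma> i < \<sigma> j" by linarith
qed

lemma card_heaps_321_le: "card (heaps_321 k n) \<le> 4 ^ n"
proof -
  let ?f = "\<lambda>\<sigma>. (lr_maxima n \<sigma>, \<sigma> ` lr_maxima n \<sigma>)"
  have perm: "\<sigma> permutes {1..n}" "avoids_321 n \<sigma>" if "\<sigma> \<in> heaps_321 k n" for \<sigma>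
    using that by (auto simp: heaps_321_def kary_heap_def)
  have sub: "lr_maxima n \<sigma> \<subseteq> {1..n}" for \<sigma> by (auto simp: lr_maxima_def)
  have "inj_on ?f (heaps_321 k n)"
  proof (rule inj_onI)
    fix \<sigma> \<tau> assume H: "\<sigma> \<in> heaps_321 k n" "\<tau> \<in> heaps_321 k n" "?f \<sigma> = ?f \<tau>"
    then have R: "lr_maxima n \<tau> = lr_maxima n \<sigma>" "\<tau> ` lr_maxima n \<sigma> = \<sigma> ` lr_maxima n \<sigma>" by auto
    \<comment> \<open>The values at the remaining positions form the complement of the values at the
      maxima, so these two sets of values agree for \<sigma> and \<tau> as well.\<close>
    have img: "\<rho> ` ({1..n} - R) = {1..n} - \<rho> ` R" if "\<rho> permutes {1..n}" for \<rho> R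
      using permutes_image[OF that] permutes_inj[OF that] by (simp add: image_set_diff)
    have "\<sigma> i = \<tau> i" if "i \<in> {1..n}" for i
    proof (cases "i \<in> lr_maxima n \<sigma>")
      case True
      then show ?thesis
        using strict_mono_on_image_eqD[OF strict_mono_on_lr_maxima[of n \<sigma>], of \<tau> i]
          strict_mono_on_lr_maxima[of n \<tau>] R by simp
    next
      case False
      then show ?thesis
        using strict_mono_on_image_eqD[OF strict_mono_on_non_lr_maxima[OF perm[OF H(1)]], of \<tau> i]
          strict_mono_on_non_lr_maxima[OF perm[OF H(2)]] R that
          img[OF perm(1)[OF H(1)]] img[OF perm(1)[OF H(2)]] by simp
    qed
    then show "\<sigma> = \<tau>"
      using permutes_not_in[OF perm(1)[OF H(1)]] permutes_not_in[OF perm(1)[OF H(2)]] by (metis ext)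
  qed
  moreover have "?f ` heaps_321 k n \<subseteq> Pow {1..n} \<times> Pow {1..n}"
  proof
    fix x assume "x \<in> ?f ` heaps_321 k n"
    then obtain \<sigma> where \<sigma>: "\<sigma> \<in> heaps_321 k n" "x = ?f \<sigma>" by blast
    then show "x \<in> Pow {1..n} \<times> Pow {1..n}"
      using sub[of \<sigma>] permutes_image[OF perm(1)[OF \<sigma>(1)]] by blast
  qed
  ultimately have "card (heaps_321 k n) \<le> card (Pow {1..n} \<times> Pow {1..n})"
    by (rule card_inj_on_le) simp
  also have "\<dots> = 4 ^ n" by (simp add: card_Pow power_mult_distrib[symmetric])
  finally show ?thesis .
qed

section \<open>Permutations from pairs of sets\<close>

text \<open>For finite sets of equal size: the \<open>j\<close>-th smallest element of
  \<open>A\<close> is strictly below the \<open>j\<close>-th smallest of \<open>B\<close>.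
  Strictness comes from \<open>Suc t\<close> on one side only.\<close>

definition dominated :: "nat set \<Rightarrow> nat set \<Rightarrow> bool" where
  "dominated A B \<longleftrightarrow> (\<forall>t. card (B \<inter> {..<Suc t}) \<le> card (A \<inter> {..<t}))"

text \<open>Positions start at 0, so that blocks of length \<open>m\<close> are the classes of
  \<open>i div m\<close>. For heaps on \<open>{1..n}\<close> this is used with \<open>Suc n\<close>
  and 0 fixed.\<close>

definition two_increasing :: "nat \<Rightarrow> nat set \<Rightarrow> nat set \<Rightarrow> (nat \<Rightarrow> nat) \<Rightarrow> bool" where
  "two_increasing n A B \<sigma> \<longleftrightarrow> \<sigma> permutes {..<n} \<and> A \<subseteq> {..<n} \<and> \<sigma> ` A = B \<and>
     strict_mono_on A \<sigma> \<and> strict_mono_on ({..<n} - A) \<sigma>"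

lemma two_increasing_image_diff:
  assumes "two_increasing n A B \<sigma>"
  shows "\<sigma> ` ({..<n} - A) = {..<n} - B"
  using assms permutes_image[of \<sigma> "{..<n}"] permutes_inj[of \<sigma> "{..<n}"]
  unfolding two_increasing_def by (simp add: image_set_diff)

lemma two_increasing_subset:
  assumes "two_increasing n A B \<sigma>"
  shows "B \<subseteq> {..<n}"
  using assms permutes_image[of \<sigma> "{..<n}"] unfolding two_increasing_def by blast

lemma ex_two_increasing:
  assumes "A \<subseteq> {..<n}" "B \<subseteq> {..<n}" "card A = card B"
  shows "\<exists>\<sigma>. two_increasing n A B \<sigma>"
proof -
  have fin: "finite A" "finite B" using assms finite_subset by auto
  obtain f where f: "strict_mono_on A f" "f ` A = B"
    using ex_strict_mono_on_image_eq[OF fin assms(3)] by blast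
  have "card ({..<n} - A) = card ({..<n} - B)" using assms fin by (simp add: card_Diff_subset)
  then obtain g where g: "strict_mono_on ({..<n} - A) g" "g ` ({..<n} - A) = {..<n} - B"
    using ex_strict_mono_on_image_eq[of "{..<n} - A" "{..<n} - B"] by auto
  define \<sigma> where "\<sigma> i = (if i \<in> A then f i else if i < n then g i else i)" for i
  have im1: "\<sigma> ` A = B" using f(2) by (auto simp: \<sigma>_def)
  have "\<sigma> ` ({..<n} - A) = g ` ({..<n} - A)" by (rule image_cong) (auto simp: \<sigma>_def)
  then have im2: "\<sigma> ` ({..<n} - A) = {..<n} - B" using g(2) by simp
  have "\<sigma> ` {..<n} = \<sigma> ` A \<union> \<sigma> ` ({..<n} - A)" using assms(1) by blast
  then have im: "\<sigma> ` {..<n} = {..<n}" using im1 im2 assms(2) by auto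
  have "bij_betw \<sigma> {..<n} {..<n}"
    using im by (simp add: bij_betw_def finite_surj_inj)
  then have "\<sigma> permutes {..<n}"
    by (rule bij_imp_permutes) (use assms(1) in \<open>auto simp: \<sigma>_def\<close>)
  moreover have "strict_mono_on A \<sigma>" "strict_mono_on ({..<n} - A) \<sigma>"
    using f(1) g(1) by (auto simp: strict_mono_on_def \<sigma>_def)
  ultimately show ?thesis using assms(1) im1 unfolding two_increasing_def by blast
qed

text \<open>If \<open>A\<close> and \<open>B\<close> have equally many elements below
  \<open>t\<close>, so do their complements, and the rank tests for \<open>\<sigma> i < t\<close>
  and \<open>i < t\<close> coincide. Thus \<sigma> respects every balanced cut.\<close>

lemma two_increasing_less_iff:
  assumes \<sigma>: "two_increasing n A B \<sigma>" and t: "t \<le> n" "i < n"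
    and bal: "card (A \<inter> {..<t}) = card (B \<inter> {..<t})"
  shows "\<sigma> i < t \<longleftrightarrow> i < t"
proof (cases "i \<in> A")
  case True
  have "\<sigma> i < t \<longleftrightarrow> card (A \<inter> {..<i}) < card (B \<inter> {..<t})"
    using strict_mono_on_less_iff_card_below[of A \<sigma> i t] True \<sigma> unfolding two_increasing_def by simp
  then show ?thesis using card_below_less_iff[OF True, of t] bal by simp
next
  case False
  with t have i: "i \<in> {..<n} - A" by simp
  have A: "A \<subseteq> {..<n}" and B: "B \<subseteq> {..<n}"
    using \<sigma> two_increasing_subset[OF \<sigma>] unfolding two_increasing_def by auto
  have "card (({..<n} - A) \<inter> {..<t}) = card (({..<n} - B) \<inter> {..<t})"
    using card_below_diff[OF A t(1)] card_below_diff[OF B t(1)] bal by linarith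
  moreover have "\<sigma> i < t \<longleftrightarrow> card (({..<n} - A) \<inter> {..<i}) < card (({..<n} - B) \<inter> {..<t})"
    using strict_mono_on_less_iff_card_below[of "{..<n} - A" \<sigma> i t] i \<sigma>
      two_increasing_image_diff[OF \<sigma>] unfolding two_increasing_def by simp
  ultimately show ?thesis using card_below_less_iff[OF i, of t] by simp
qed

text \<open>The rank test at threshold \<open>Suc i\<close> decides whether
  \<open>\<sigma> i \<le> i\<close>. Domination makes it fail on \<open>A\<close>; passing to
  complements reverses the counts and makes it succeed elsewhere.\<close>

lemma two_increasing_excedance_iff:
  assumes \<sigma>: "two_increasing n A B \<sigma>" and dom: "dominated A B" and "i < n"
  shows "i < \<sigma> i \<longleftrightarrow> i \<in> A"
proof (cases "i \<in> A")
  case True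
  have "\<sigma> i < Suc i \<longleftrightarrow> card (A \<inter> {..<i}) < card (B \<inter> {..<Suc i})"
    using strict_mono_on_less_iff_card_below[of A \<sigma> i "Suc i"] True \<sigma>
    unfolding two_increasing_def by simp
  then show ?thesis using dom True unfolding dominated_def by (metis not_le less_Suc_eq_le)
next
  case False
  with assms have i: "i \<in> {..<n} - A" by simp
  have A: "A \<subseteq> {..<n}" and B: "B \<subseteq> {..<n}"
    using \<sigma> two_increasing_subset[OF \<sigma>] unfolding two_increasing_def by auto
  have le: "i \<le> n" "Suc i \<le> n" using assms(3) by auto
  have "\<sigma> i < Suc i \<longleftrightarrow> card (({..<n} - A) \<inter> {..<i}) < card (({..<n} - B) \<inter> {..<Suc i})"
    using strict_mono_on_less_iff_card_below[of "{..<n} - A" \<sigma> i "Suc i"] i \<sigma>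
      two_increasing_image_diff[OF \<sigma>] unfolding two_increasing_def by simp
  moreover have "card (B \<inter> {..<Suc i}) \<le> card (A \<inter> {..<i})"
    using dom by (simp add: dominated_def)
  ultimately have "\<sigma> i < Suc i"
    using card_below_diff[OF A le(1)] card_below_diff[OF B le(2)] by linarith
  then show ?thesis using False by simp
qed

text \<open>Every cut up to \<open>m\<close> is balanced, both counts being 0; the cuts at
  \<open>i\<close> and \<open>Suc i\<close> then pin down the value.\<close>

lemma two_increasing_fixed:
  assumes \<sigma>: "two_increasing n A B \<sigma>" and dom: "dominated A B"
    and "m \<le> n" "A \<inter> {..<m} = {}" "B \<inter> {..<m} = {}" "i < m"
  shows "\<sigma> i = i"
proof -
  have bal: "\<sigma> i < t \<longleftrightarrow> i < t" if "t \<le> m" for t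
  proof -
    have "A \<inter> {..<t} = {}" "B \<inter> {..<t} = {}"
      using assms(4,5) that by (auto simp: disjoint_iff)
    then show ?thesis
      using two_increasing_less_iff[OF \<sigma>, of t i] that assms(3,6) by simp
  qed
  from bal[of i] bal[of "Suc i"] assms(6) show ?thesis by simp
qed

text \<open>Among three positions two lie on the same side of \<open>A\<close>, where \<sigma>
  increases.\<close>

lemma two_increasing_avoids_321:
  assumes \<sigma>: "two_increasing (Suc n) A B \<sigma>"
  shows "avoids_321 n \<sigma>"
proof -
  have up: "\<sigma> i < \<sigma> j" if "i \<in> A \<longleftrightarrow> j \<in> A" "i < j" "j \<le> n" for i j
    using \<sigma> that unfolding two_increasing_def strict_mono_on_def
    by (cases "j \<in> A") auto
  show ?thesis unfolding avoids_321_def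
  proof clarify
    fix a b c assume *: "a \<in> {1..n}" "b \<in> {1..n}" "c \<in> {1..n}" "a < b" "b < c"
      "\<sigma> b < \<sigma> a" "\<sigma> c < \<sigma> b"
    then show False using up[of a b] up[of b c] up[of a c] by auto
  qed
qed

text \<open>A child of a vertex \<open>i\<close> sits at a position at least \<open>2 i\<close>, hence outside the block of
  length \<open>m\<close> of \<open>i\<close> unless \<open>i < m\<close>, and inversions never leave a block.\<close>
lemma two_increasing_kary_heap:
  assumes \<sigma>: "two_increasing (Suc n) A B \<sigma>" and dom: "dominated A B"
    and k: "k \<ge> 2" and m: "0 < m" "m \<le> Suc n" "A \<inter> {..<m} = {}" "B \<inter> {..<m} = {}"
    and bal: "\<And>b. card (A \<inter> {..<b * m}) = card (B \<inter> {..<b * m})"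
  shows "kary_heap k n \<sigma>"
proof -
  have fixed: "\<sigma> i = i" if "i < m" for i
    using two_increasing_fixed[OF \<sigma> dom m(2-4) that] .
  have perm: "\<sigma> permutes {..<Suc n}" using \<sigma> by (simp add: two_increasing_def)
  have "\<sigma> permutes {1..n}"
  proof (rule permutes_superset[OF perm])
    fix x assume "x \<in> {..<Suc n} - {1..n}"
    then have "x = 0" by auto
    then show "\<sigma> x = x" using fixed[of 0] m(1) by simp
  qed
  moreover have "\<sigma> i < \<sigma> j" if ij: "i \<in> {1..n}" "j \<in> tree_children k n i" for i j
  proof -
    have "k * (i - 1) + 2 \<le> j" "j \<le> n" using ij by (auto simp: tree_children_def)
    moreover have "2 * (i - 1) \<le> k * (i - 1)" using k by (rule mult_le_mono1)
    moreover have "2 * (i - 1) + 2 = 2 * i" "0 < i" using ij(1) by auto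
    ultimately have j: "2 * i \<le> j" "j \<le> n" "i < j" by linarith+
    have lt: "\<sigma> x < b * m \<longleftrightarrow> x < b * m" if "b * m \<le> j" "x \<le> n" for b x
      using two_increasing_less_iff[OF \<sigma> _ _ bal[of b], of x] that j by simp
    show ?thesis
    proof (cases "j < m")
      case True
      then show ?thesis using fixed[of i] fixed[of j] j by simp
    next
      case False
      \<comment> \<open>The block of \<open>j\<close> starts at \<open>?b * m\<close>. From
        \<open>2 * i \<le> j < ?b * m + m \<le> 2 * ?b * m\<close> the parent lies before this
        balanced cut, so the cut separates the two values too.\<close>
      let ?b = "j div m"
      have "0 < ?b" using m(1) False by (simp add: div_greater_zero_iff)
      then have b: "?b * m \<le> j" "j < ?b * m + m" "m \<le> ?b * m"
        using m(1) dividend_less_div_times[OF m(1), of j] by auto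
      have "i < ?b * m" using j b by linarith
      then show ?thesis using lt[OF b(1), of i] lt[OF b(1), of j] b(1) j by simp
    qed
  qed
  ultimately show ?thesis unfolding kary_heap_def by blast
qed

section \<open>Gluing blocks\<close>

definition glue :: "nat \<Rightarrow> (nat \<Rightarrow> nat set) \<Rightarrow> nat set" where
  "glue m F = {i. i mod m \<in> F (i div m)}"

text \<open>Whole blocks contribute their full size and the last one its initial part. Allowing
  \<open>r = m\<close> lets the induction hypothesis count a completed block.\<close>

lemma card_glue_below:
  assumes F: "\<And>b. F b \<subseteq> {..<m}" and "r \<le> m" "0 < m"
  shows "card (glue m F \<inter> {..<b * m + r}) = (\<Sum>c<b. card (F c)) + card (F b \<inter> {..<r})"
  using \<open>r \<le> m\<close>
proof (induction b arbitrary: r)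
  have split: "card (glue m F \<inter> {..<b * m + r}) =
      card (glue m F \<inter> {..<b * m}) + card (F b \<inter> {..<r})" if "r \<le> m" for b r
  proof -
    have "glue m F \<inter> {..<b * m + r} = glue m F \<inter> {..<b * m} \<union> (\<lambda>x. b * m + x) ` (F b \<inter> {..<r})"
      (is "?L = ?A \<union> ?B")
    proof (intro set_eqI iffI)
      fix x assume x: "x \<in> ?L"
      show "x \<in> ?A \<union> ?B"
      proof (cases "x < b * m")
        case False
        then obtain y where y: "x = b * m + y" by (metis le_add_diff_inverse not_less)
        with x that have "y < r" "y < m" by auto
        then have "y \<in> F b" using x y by (auto simp: glue_def)
        with y \<open>y < r\<close> show ?thesis by auto
      qed (use x in auto)
    next
      fix x assume "x \<in> ?A \<union> ?B"
      then show "x \<in> ?L" using F[of b] that by (auto simp: glue_def subset_iff)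
    qed
    moreover have "card (?A \<union> ?B) = card ?A + card ?B" by (rule card_Un_disjoint) auto
    moreover have "card ?B = card (F b \<inter> {..<r})" by (simp add: card_image)
    ultimately show ?thesis by simp
  qed
  case 0
  then show ?case using split[of r 0] by simp
  case (Suc b)
  have "F b \<inter> {..<m} = F b" using F by blast
  then show ?case using split[OF Suc.prems, of "Suc b"] Suc.IH[of m] by (simp add: add.commute)
qed

text \<open>Functions in \<open>I \<rightarrow>\<^sub>E S\<close> are \<open>undefined\<close> off
  \<open>I\<close>; the default \<open>d\<close> prescribes the blocks there.\<close>

definition fill :: "nat set \<Rightarrow> (nat \<Rightarrow> 'a) \<Rightarrow> (nat \<Rightarrow> 'a) \<Rightarrow> nat \<Rightarrow> 'a" where
  "fill I d f b = (if b \<in> I then f b else d b)"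

definition glue2 :: "nat \<Rightarrow> (nat \<Rightarrow> nat set \<times> nat set) \<Rightarrow> nat set \<times> nat set" where
  "glue2 m f = (glue m (fst \<circ> f), glue m (snd \<circ> f))"

text \<open>Since each pattern lies in \<open>{..<m}\<close>, block \<open>b\<close> of the glued
  set, shifted back by \<open>b * m\<close>, returns the pattern.\<close>

lemma inj_on_glue2_fill:
  assumes S: "S \<subseteq> Pow {..<m} \<times> Pow {..<m}"
  shows "inj_on (\<lambda>f. glue2 m (fill I d f)) (I \<rightarrow>\<^sub>E S)"
proof (rule inj_onI)
  fix f g assume fg: "f \<in> I \<rightarrow>\<^sub>E S" "g \<in> I \<rightarrow>\<^sub>E S" "glue2 m (fill I d f) = glue2 m (fill I d g)"
  have mem: "glue m F = glue m G \<Longrightarrow> F b \<subseteq> {..<m} \<Longrightarrow> F b \<subseteq> G b" for F G b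
  proof
    fix x assume *: "glue m F = glue m G" "F b \<subseteq> {..<m}" "x \<in> F b"
    then have "x < m" by auto
    then have "b * m + x \<in> glue m F" using *(3) by (simp add: glue_def)
    then have "b * m + x \<in> glue m G" unfolding *(1) .
    then show "x \<in> G b" using \<open>x < m\<close> by (simp add: glue_def)
  qed
  show "f = g"
  proof (rule PiE_ext[OF fg(1,2)])
    fix b assume b: "b \<in> I"
    have eq: "glue m (fst \<circ> fill I d f) = glue m (fst \<circ> fill I d g)"
      "glue m (snd \<circ> fill I d f) = glue m (snd \<circ> fill I d g)"
      using fg(3) by (auto simp: glue2_def)
    have in_S: "f b \<in> Pow {..<m} \<times> Pow {..<m}" "g b \<in> Pow {..<m} \<times> Pow {..<m}"
      using fg b S by blast+
    have "fst (f b) = fst (g b)"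
      using mem[OF eq(1), of b] mem[OF eq(1)[symmetric], of b] in_S b
      by (auto simp: fill_def mem_Times_iff)
    moreover have "snd (f b) = snd (g b)"
      using mem[OF eq(2), of b] mem[OF eq(2)[symmetric], of b] in_S b
      by (auto simp: fill_def mem_Times_iff)
    ultimately show "f b = g b" by (simp add: prod_eq_iff)
  qed
qed

definition dominated_pairs :: "nat \<Rightarrow> (nat set \<times> nat set) set" where
  "dominated_pairs m = {(A, B). A \<subseteq> {..<m} \<and> B \<subseteq> {..<m} \<and> card A = card B \<and> dominated A B}"

definition balanced_pairs :: "nat \<Rightarrow> (nat set \<times> nat set) set" where
  "balanced_pairs m = {(A, B). A \<subseteq> {..<m} \<and> B \<subseteq> {..<m} \<and> card A = card B}"

lemma finite_dominated_pairs [simp]: "finite (dominated_pairs m)"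
  by (rule finite_subset[of _ "Pow {..<m} \<times> Pow {..<m}"]) (auto simp: dominated_pairs_def)

text \<open>Sorting pairs by their common size gives the sum of the squares of
  \<open>m choose j\<close>, which is the central binomial coefficient.\<close>

lemma card_balanced_pairs: "card (balanced_pairs m) = (2 * m) choose m"
proof -
  let ?N = "\<lambda>j. {A. A \<subseteq> {..<m} \<and> card A = j}"
  have "balanced_pairs m = (\<Union>j\<le>m. ?N j \<times> ?N j)"
    using card_mono[of "{..<m}"] by (fastforce simp: balanced_pairs_def)
  moreover have "card (\<Union>j\<le>m. ?N j \<times> ?N j) = (\<Sum>j\<le>m. card (?N j \<times> ?N j))"
    by (rule card_UN_disjoint) auto
  moreover have "card (?N j \<times> ?N j) = (m choose j)\<^sup>2" for j
    using n_subsets[of "{..<m}" j] by (simp add: card_cartesian_product power2_eq_square)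
  ultimately show ?thesis by (simp add: choose_square_sum)
qed

lemma glue_subset_lessThan:
  assumes "\<And>b. F b \<subseteq> {..<m}" "\<And>b. b \<ge> q \<Longrightarrow> F b = {}"
  shows "glue m F \<subseteq> {..<q * m}"
proof
  fix x assume "x \<in> glue m F"
  then have "x div m < q" using assms(2)[of "x div m"] by (auto simp: glue_def not_le[symmetric])
  then show "x \<in> {..<q * m}" using assms(1)
    by (metis \<open>x \<in> glue m F\<close> div_less_iff_less_mult glue_def lessThan_iff mem_Collect_eq
        mod_less_divisor not_gr_zero not_less_zero subsetD mult_0_right)
qed

text \<open>The hypothesis is domination at \<open>t = b * m + r\<close> with both counts expanded
  blockwise; as \<open>r < m\<close>, also \<open>Suc r\<close> stays within the block.\<close>

lemma dominated_glue:
  assumes F: "\<And>b. F b \<subseteq> {..<m}" and G: "\<And>b. G b \<subseteq> {..<m}" and "0 < m"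
    and le: "\<And>b r. r < m \<Longrightarrow> (\<Sum>c<b. card (G c)) + card (G b \<inter> {..<Suc r}) \<le>
        (\<Sum>c<b. card (F c)) + card (F b \<inter> {..<r})"
  shows "dominated (glue m F) (glue m G)"
  unfolding dominated_def
proof
  fix t
  define b r where "b = t div m" and "r = t mod m"
  have t: "t = b * m + r" "Suc t = b * m + Suc r" "r < m" using \<open>0 < m\<close> by (auto simp: b_def r_def)
  have "card (glue m G \<inter> {..<b * m + Suc r}) \<le> card (glue m F \<inter> {..<b * m + r})"
    using le[OF t(3)] t(3) \<open>0 < m\<close> by (simp only: card_glue_below[OF F] card_glue_below[OF G])
  then show "card (glue m G \<inter> {..<Suc t}) \<le> card (glue m F \<inter> {..<t})"
    using t by simp
qed

section \<open>The lower bound\<close>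

text \<open>Each of the blocks 1 to \<open>q\<close> receives a dominated pair of its own. Positions
  from \<open>(q + 1) * m\<close> on lie in neither glued set. Distinct choices give distinct heaps
  because excedances reveal the glued sets.\<close>

lemma card_heaps_321_ge:
  assumes k: "k \<ge> 2" and m: "0 < m" "(q + 1) * m \<le> Suc n"
  shows "card (dominated_pairs m) ^ q \<le> card (heaps_321 k n)"
proof -
  \<comment> \<open>Block 0 is left empty: the first \<open>m\<close> positions are fixed. They include the position 0, which
    is not a vertex of the tree.\<close>
  define h where "h = fill {1..q} (\<lambda>_. ({} :: nat set, {} :: nat set))"
  define X where "X = ({1..q} \<rightarrow>\<^sub>E dominated_pairs m)"
  define \<Phi> where "\<Phi> f = (SOME \<sigma>. two_increasing (Suc n) (fst (glue2 m (h f))) (snd (glue2 m (h f))) \<sigma>)" for f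
  have mem: "h f b \<in> dominated_pairs m" if "f \<in> X" for f b
  proof (cases "b \<in> {1..q}")
    case True
    then show ?thesis using that by (auto simp: h_def fill_def X_def)
  qed (auto simp: h_def fill_def dominated_pairs_def dominated_def)
  have props: "two_increasing (Suc n) (fst (glue2 m (h f))) (snd (glue2 m (h f))) (\<Phi> f)
      \<and> dominated (fst (glue2 m (h f))) (snd (glue2 m (h f))) \<and> \<Phi> f \<in> heaps_321 k n"
    if f: "f \<in> X" for f
  proof -
    let ?F = "fst \<circ> h f" and ?G = "snd \<circ> h f"
    have F: "?F b \<subseteq> {..<m}" and G: "?G b \<subseteq> {..<m}" and FG: "card (?F b) = card (?G b)"
      and dom: "dominated (?F b) (?G b)" for b
      using mem[OF f, of b] by (auto simp: dominated_pairs_def)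
    have empty: "?F b = {}" "?G b = {}" if "b = 0 \<or> b > q" for b
      using that by (auto simp: h_def fill_def)
    have sub: "glue m ?F \<subseteq> {..<(q + 1) * m}" "glue m ?G \<subseteq> {..<(q + 1) * m}"
      using glue_subset_lessThan[of ?F m "q + 1", OF F empty(1)]
        glue_subset_lessThan[of ?G m "q + 1", OF G empty(2)]
      by fastforce+
    have "{..<(q + 1) * m} \<subseteq> {..<Suc n}" using m(2) by auto
    note sub' = sub[THEN subset_trans, OF this]
    \<comment> \<open>Offset 0: equal sizes in every block balance all cuts at multiples of
      \<open>m\<close>.\<close>
    have bal: "card (glue m ?F \<inter> {..<b * m}) = card (glue m ?G \<inter> {..<b * m})" for b
      using card_glue_below[of ?F m 0 b, OF F] card_glue_below[of ?G m 0 b, OF G] m(1) FG by simp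
    have card: "card (glue m ?F) = card (glue m ?G)"
      using bal[of "q + 1"] by (simp only: Int_absorb2[OF sub(1)] Int_absorb2[OF sub(2)])
    have dom': "dominated (glue m ?F) (glue m ?G)"
    proof (rule dominated_glue[OF F G m(1)])
      fix b r
      show "(\<Sum>c<b. card (?G c)) + card (?G b \<inter> {..<Suc r}) \<le>
        (\<Sum>c<b. card (?F c)) + card (?F b \<inter> {..<r})"
        using dom[of b] FG unfolding dominated_def by simp
    qed
    have two: "two_increasing (Suc n) (glue m ?F) (glue m ?G) (\<Phi> f)"
      unfolding \<Phi>_def glue2_def fst_conv snd_conv
      using someI_ex[OF ex_two_increasing[OF sub' card]] .
    have "glue m ?F \<inter> {..<m} = {}" "glue m ?G \<inter> {..<m} = {}"
      using empty[of 0] by (auto simp: glue_def)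
    then have "kary_heap k n (\<Phi> f)"
      using two_increasing_kary_heap[OF two dom' k m(1) _ _ _ bal] m by simp
    then show ?thesis using two dom' two_increasing_avoids_321[OF two]
      by (simp add: glue2_def heaps_321_def)
  qed
  \<comment> \<open>The excedances are \<open>A\<close>, and \<open>B\<close> is their image, so the
    permutation determines the pair.\<close>
  have recover: "A = {i \<in> {..<N}. i < \<sigma> i} \<and> B = \<sigma> ` {i \<in> {..<N}. i < \<sigma> i}"
    if "two_increasing N A B \<sigma>" "dominated A B" for N A B \<sigma>
  proof -
    have "A = {i \<in> {..<N}. i < \<sigma> i}"
      using two_increasing_excedance_iff[OF that] that(1) unfolding two_increasing_def by auto
    then show ?thesis using that(1) unfolding two_increasing_def by blast
  qed
  have "inj_on \<Phi> X"
  proof (rule inj_onI)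
    fix f g assume fg: "f \<in> X" "g \<in> X" "\<Phi> f = \<Phi> g"
    have "glue2 m (h f) = glue2 m (h g)"
      using recover props[OF fg(1)] props[OF fg(2)] fg(3) by (metis prod_eq_iff)
    then show "f = g"
      using inj_on_glue2_fill[of "dominated_pairs m" m "{1..q}"] fg(1,2)
      unfolding h_def X_def inj_on_def by (auto simp: dominated_pairs_def)
  qed
  then have "card X \<le> card (heaps_321 k n)"
    by (rule card_inj_on_le) (use props in auto)
  moreover have "card X = card (dominated_pairs m) ^ q"
    by (simp add: X_def card_PiE)
  ultimately show ?thesis by simp
qed

text \<open>The extra first block gives \<open>A\<close> a lead of \<open>L\<close> elements over
  \<open>B\<close>. The middle blocks are arbitrary balanced pairs: inside one block
  \<open>B\<close> catches up by at most \<open>L\<close>. The extra last block of \<open>B\<close>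
  makes the sizes equal.\<close>

lemma card_dominated_pairs_ge:
  assumes L: "0 < L"
  shows "((2 * L) choose L) ^ q \<le> card (dominated_pairs ((q + 2) * L))"
proof -
  define d :: "nat \<Rightarrow> nat set \<times> nat set"
    where "d b = (if b = 0 then {..<L} else {}, if b = q + 1 then {..<L} else {})" for b
  define h where "h = fill {1..q} d"
  define X where "X = ({1..q} \<rightarrow>\<^sub>E balanced_pairs L)"
  have "inj_on (\<lambda>f. glue2 L (h f)) X" unfolding h_def X_def
    by (rule inj_on_glue2_fill) (auto simp: balanced_pairs_def)
  moreover have "(\<lambda>f. glue2 L (h f)) ` X \<subseteq> dominated_pairs ((q + 2) * L)"
  proof (rule image_subsetI)
    fix f assume f: "f \<in> X"
    let ?F = "fst \<circ> h f" and ?G = "snd \<circ> h f"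
    have in_B: "f b \<in> balanced_pairs L" if "b \<in> {1..q}" for b using f that by (auto simp: X_def)
    have F: "?F b \<subseteq> {..<L}" and G: "?G b \<subseteq> {..<L}" for b
      using in_B[of b] by (auto simp: h_def fill_def d_def balanced_pairs_def subset_iff split: prod.splits)
    have mid: "card (?F b) = card (?G b)" if "b \<in> {1..q}" for b
      using in_B[OF that] that by (auto simp: h_def fill_def balanced_pairs_def)
    have out: "?F b = (if b = 0 then {..<L} else {})" "?G b = (if b = q + 1 then {..<L} else {})"
      if "b \<notin> {1..q}" for b
      using that by (auto simp: h_def fill_def d_def)
    \<comment> \<open>At the start of block \<open>b\<close> the lead of \<open>A\<close> is exactly
      \<open>L\<close> for \<open>1 \<le> b \<le> q + 1\<close>, and 0 otherwise.\<close>
    have sums: "(\<Sum>c<b. card (?F c)) + (if b > q + 1 then L else 0) =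
        (\<Sum>c<b. card (?G c)) + (if b > 0 then L else 0)" for b
    proof (induction b)
      case (Suc b)
      show ?case
      proof (cases "b \<in> {1..q}")
        case True
        then show ?thesis using Suc mid[OF True] by (auto simp del: comp_apply)
      next
        case False
        then show ?thesis using Suc out[OF False] by (auto simp del: comp_apply)
      qed
    qed simp
    have dom: "dominated (glue L ?F) (glue L ?G)"
    proof (rule dominated_glue[OF F G L])
      fix b r
      have "card (?G b \<inter> {..<Suc r}) \<le> L"
        using card_mono[of "{..<L}" "?G b \<inter> {..<Suc r}"] G[of b] by (auto simp del: comp_apply)
      moreover have "?G b \<inter> {..<Suc r} = {}" if "b = 0 \<or> b > q + 1" using that out(2)[of b] by auto
      ultimately show "(\<Sum>c<b. card (?G c)) + card (?G b \<inter> {..<Suc r}) \<le>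
          (\<Sum>c<b. card (?F c)) + card (?F b \<inter> {..<r})"
        using sums[of b] by (cases "b = 0 \<or> b > q + 1") (auto simp del: comp_apply)
    qed
    have sub: "glue L ?F \<subseteq> {..<(q + 2) * L}" "glue L ?G \<subseteq> {..<(q + 2) * L}"
      using glue_subset_lessThan[of ?F L "q + 2", OF F] glue_subset_lessThan[of ?G L "q + 2", OF G] out
      by (simp_all del: comp_apply)
    have "card (glue L ?F \<inter> {..<(q + 2) * L}) = card (glue L ?G \<inter> {..<(q + 2) * L})"
      using card_glue_below[of ?F L 0 "q + 2", OF F] card_glue_below[of ?G L 0 "q + 2", OF G] L
        sums[of "q + 2"] by (simp del: comp_apply)
    then have "card (glue L ?F) = card (glue L ?G)" using sub by (simp add: Int_absorb2)
    then show "glue2 L (h f) \<in> dominated_pairs ((q + 2) * L)"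
      using sub dom by (simp add: glue2_def dominated_pairs_def del: comp_apply)
  qed
  ultimately have "card X \<le> card (dominated_pairs ((q + 2) * L))"
    by (rule card_inj_on_le) simp
  then show ?thesis by (simp add: X_def card_PiE card_balanced_pairs)
qed

text \<open>Take \<open>L\<close> middle blocks of length \<open>L\<close>, so
  \<open>m = (L + 2) * L\<close>. The central binomial bound gives at least
  \<open>(4 ^ L / (2 * L)) ^ L\<close> pairs, and the \<open>m\<close>-th root of this tends to
  4.\<close>

lemma ex_dominated_pairs_growth:
  fixes c :: real
  assumes "c < 4"
  shows "\<exists>m>0. 0 < card (dominated_pairs m) \<and> c < real (card (dominated_pairs m)) powr (1 / real m)"
proof -
  have "(\<lambda>L::nat. (4 ^ L / (2 * real L)) powr (1 / (real L + 2))) \<longlonglongrightarrow> 4" by real_asymp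
  then have "\<forall>\<^sub>F L in sequentially. c < (4 ^ L / (2 * real L)) powr (1 / (real L + 2))"
    using assms by (rule order_tendstoD)
  then have "\<forall>\<^sub>F L in sequentially. L > 0 \<and> c < (4 ^ L / (2 * real L)) powr (1 / (real L + 2))"
    using eventually_gt_at_top[of "0::nat"] by eventually_elim simp
  then obtain L :: nat where L: "L > 0" "c < (4 ^ L / (2 * real L)) powr (1 / (real L + 2))"
    unfolding eventually_sequentially by blast
  let ?m = "(L + 2) * L" and ?x = "4 ^ L / (2 * real L)"
  have "?x \<le> real ((2 * L) choose L)" using central_binomial_lower_bound[OF L(1)] .
  then have "?x ^ L \<le> real ((2 * L) choose L) ^ L" by (intro power_mono) auto
  also have "\<dots> \<le> real (card (dominated_pairs ?m))"
    using card_dominated_pairs_ge[OF L(1), of L] by (metis of_nat_le_iff of_nat_power)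
  finally have le: "?x ^ L \<le> real (card (dominated_pairs ?m))" .
  have x: "0 < ?x" using L(1) by simp
  have "real ?m = (real L + 2) * real L" by (simp add: algebra_simps)
  then have "1 / (real L + 2) = real L * (1 / real ?m)" using L(1) by (simp only:) simp
  then have "?x powr (1 / (real L + 2)) = (?x ^ L) powr (1 / real ?m)"
    using x by (simp only: powr_realpow[symmetric] powr_powr)
  also have "\<dots> \<le> real (card (dominated_pairs ?m)) powr (1 / real ?m)"
    using le x by (intro powr_mono2) auto
  finally have "c < real (card (dominated_pairs ?m)) powr (1 / real ?m)" using L(2) by linarith
  moreover have "0 < ?x ^ L" using x by simp
  then have "0 < card (dominated_pairs ?m)" using le by linarith
  ultimately show ?thesis using L(1) by (intro exI[of _ ?m]) auto
qed

section \<open>The limit of the \<open>n\<close>-th roots\<close>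

theorem corollary2p1:
  fixes k :: nat
  assumes "k \<ge> 2"
  shows "(\<lambda>n. real (card (heaps_321 k n)) powr (1 / real n)) \<longlonglongrightarrow> 4"
proof (rule order_tendstoI)
  fix c :: real assume "4 < c"
  have "real (card (heaps_321 k n)) powr (1 / real n) < c" if "n > 0" for n
  proof -
    have "real (card (heaps_321 k n)) \<le> 4 ^ n"
      using card_heaps_321_le[of k n] by (metis of_nat_le_iff of_nat_numeral of_nat_power)
    then have "real (card (heaps_321 k n)) powr (1 / real n) \<le> (4 ^ n) powr (1 / real n)"
      by (intro powr_mono2) auto
    also have "\<dots> = 4" using that by (simp add: powr_realpow[symmetric] powr_powr)
    finally show ?thesis using \<open>4 < c\<close> by simp
  qed
  then show "\<forall>\<^sub>F n in sequentially. real (card (heaps_321 k n)) powr (1 / real n) < c"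
    using eventually_gt_at_top[of "0::nat"] by (rule eventually_mono[rotated]) auto
next
  fix c :: real assume "c < 4"
  then obtain m where m: "m > 0" "0 < card (dominated_pairs m)"
    "c < real (card (dominated_pairs m)) powr (1 / real m)"
    using ex_dominated_pairs_growth by blast
  define a where "a = real (card (dominated_pairs m))"
  have a: "a \<ge> 1" using m(2) by (simp add: a_def)
  \<comment> \<open>The loss \<open>2 / n\<close> in the exponent accounts for two blocks: the empty
    block 0 and the incomplete one at the end.\<close>
  have "(\<lambda>n. a powr (1 / real m - 2 / real n)) \<longlonglongrightarrow> a powr (1 / real m - 0)"
    using a by (intro tendsto_intros) (auto intro: real_tendsto_divide_at_top filterlim_real_sequentially)
  then have "\<forall>\<^sub>F n in sequentially. c < a powr (1 / real m - 2 / real n)"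
    by (rule order_tendstoD) (use m(3) a_def in simp)
  moreover have "a powr (1 / real m - 2 / real n) \<le> real (card (heaps_321 k n)) powr (1 / real n)"
    if "n \<ge> m" for n
  proof -
    \<comment> \<open>One of the \<open>n div m\<close> complete blocks is reserved as block 0;
      \<open>n \<ge> m\<close> keeps the natural subtraction exact.\<close>
    define q where "q = n div m - 1"
    have q: "q + 1 = n div m" using that m(1) by (simp add: q_def div_greater_zero_iff Suc_leI)
    have "(q + 1) * m \<le> Suc n" unfolding q using div_times_less_eq_dividend[of n m] by linarith
    then have "card (dominated_pairs m) ^ q \<le> card (heaps_321 k n)"
      using card_heaps_321_ge[OF assms m(1)] by blast
    then have le: "a ^ q \<le> real (card (heaps_321 k n))"
      unfolding a_def by (metis of_nat_le_iff of_nat_power)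
    have n: "n > 0" using that m(1) by simp
    have "n < (n div m + 1) * m" using m(1) by (simp add: dividend_less_div_times)
    then have "real n < (real q + 2) * real m"
      unfolding q[symmetric] by (metis of_nat_less_iff of_nat_mult of_nat_add of_nat_1 add.assoc one_add_one of_nat_numeral)
    then have "real n / real m - 2 \<le> real q" using m(1) by (simp add: field_simps)
    then have "(real n / real m - 2) / real n \<le> real q / real n" using n by (intro divide_right_mono) auto
    then have "1 / real m - 2 / real n \<le> real q * (1 / real n)" using n by (simp add: field_simps)
    then have "a powr (1 / real m - 2 / real n) \<le> a powr (real q * (1 / real n))"
      using a by (intro powr_mono) auto
    also have "\<dots> = (a ^ q) powr (1 / real n)"
      using a by (simp add: powr_realpow[symmetric] powr_powr)
    also have "\<dots> \<le> real (card (heaps_321 k n)) powr (1 / real n)"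
      using le a by (intro powr_mono2) auto
    finally show ?thesis .
  qed
  then have "\<forall>\<^sub>F n in sequentially.
      a powr (1 / real m - 2 / real n) \<le> real (card (heaps_321 k n)) powr (1 / real n)"
    using eventually_ge_at_top[of m] by (rule eventually_mono[rotated]) auto
  ultimately show "\<forall>\<^sub>F n in sequentially. c < real (card (heaps_321 k n)) powr (1 / real n)"
    by eventually_elim linarith
qed

end
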